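(* Let $T$ be a tree, and let $H_1 \subseteq H_2$ be families of subtrees of $T$. Let $\sim$ be a symmetric relation on $H_2$ containing the disjointness relation (i.e., if $x, y$ are disjoint members of $H_2$, then $x \sim y$). Then $$mw(H_1,H_2,\sim) = w(H_1,H_2,\sim).$$
   Context: A family of subtrees of a tree $T$ is regarded as a hypergraph on the vertex set $V(T)$: each subtree $t$ is an edge, identified with its vertex set $V(t)$; two subtrees are disjoint (respectively, meet/intersect) if their vertex sets are disjoint (respectively, have a common vertex). A matching in a hypergraph is a set of pairwise disjoint edges. For two hypergraphs $H$ and $F$ on the same vertex set, a subset $C \subseteq F$ is called $H$-covering (or an $H$-covering) if every edge of $H$ meets some edge from $C$. Let $H_1, H_2$ be hypergraphs on the same vertex set and $\sim$ a symmetric relation on $H_2$. A subset of $H_2$ is $\sim$-related if any two (distinct) members of it are related by $\sim$. $w(H_1,H_2,\sim)$ denotes the minimal size of a $\sim$-related subset of $H_2$ which is $H_1$-covering. $mw(H_1,H_2,\sim)$ denotes the maximum, over all matchings $M$ in $H_1$, of $w(M,H_2,\sim)$.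
   Formalization: The families H1 and H2 are assumed finite (T may be infinite); for infinite families the equality can fail, e.g. on the two-way infinite path with H1 all rays (-∞,-n], [n,∞), H2 adding all [-n,n], and ~ always true (mw = 1, w = 2). *)

theory Defs
  imports "HOL-Library.Extended_Nat" "Graph_Theory.Graph_Theory"
begin

text \<open>
  Undirected simple graphs are represented, as in \<^theory>\<open>Graph_Theory.Pair_Digraph\<close>, by symmetric
  loop-free sets of ordered pairs. The library predicate \<^const>\<open>tree\<close> cannot be used for them,
  since it counts the traversal u, v, u of a single edge as a cycle. As there are no loops and no
  parallel arcs, the directed cycles of length at least 3 are exactly the cycles of the
  undirected graph. Infinite graphs are allowed; the empty graph is not connected.
\<close>

definition undirected_tree :: "'a pair_pre_digraph \<Rightarrow> bool" where
  "undirected_tree T \<longleftrightarrow> pair_bidirected_digraph T \<and> connected (with_proj T) \<and>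
     \<not> (\<exists>p. pre_digraph.cycle (with_proj T) p \<and> 3 \<le> length p)"

definition subtrees :: "'a pair_pre_digraph \<Rightarrow> 'a set set" where
  "subtrees T = {pverts t | t. subgraph (with_proj t) (with_proj T) \<and> undirected_tree t}"

definition matching_in :: "'a set set \<Rightarrow> 'a set set \<Rightarrow> bool" where
  "matching_in H M \<longleftrightarrow> M \<subseteq> H \<and> pairwise disjnt M"

definition covering :: "'a set set \<Rightarrow> 'a set set \<Rightarrow> bool" where
  "covering H C \<longleftrightarrow> (\<forall>h\<in>H. \<exists>c\<in>C. \<not> disjnt h c)"

text \<open>
  \<^const>\<open>pairwise\<close> only relates distinct members. The infimum of a nonempty set of extended naturals
  is attained; the value is \<open>\<infinity>\<close> if there is no finite related covering.
\<close>

definition w :: "'a set set \<Rightarrow> 'a set set \<Rightarrow> ('a set \<Rightarrow> 'a set \<Rightarrow> bool) \<Rightarrow> enat" where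
  "w H1 H2 sim =
     (INF C \<in> {C. C \<subseteq> H2 \<and> finite C \<and> pairwise sim C \<and> covering H1 C}. enat (card C))"

text \<open>Meaningful for finite \<open>H1\<close>, where the maximum ranges over a finite nonempty set.\<close>

definition mw :: "'a set set \<Rightarrow> 'a set set \<Rightarrow> ('a set \<Rightarrow> 'a set \<Rightarrow> bool) \<Rightarrow> enat" where
  "mw H1 H2 sim = Max {w M H2 sim | M. matching_in H1 M}"

end

theory Submission
  imports Defs
begin

text \<open>
  Choose a minimal \<open>M \<subseteq> H1\<close> with the same width \<open>k\<close> as \<open>H1\<close>. Every \<open>h \<in> M\<close> has a related covering
  \<open>C h\<close> of \<open>M - {h}\<close> with fewer than \<open>k\<close> members, none of which meets \<open>h\<close>. Suppose \<open>h, h' \<in> M\<close>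
  share a vertex \<open>x\<close> next to which a branch \<open>B\<close> of the tree at \<open>x\<close> is disjoint from \<open>h'\<close>, and some
  member of \<open>C h'\<close> meets \<open>h\<close> inside \<open>B\<close>. No member of \<open>C h\<close> or \<open>C h'\<close> contains \<open>x\<close>, so both split
  into a part inside \<open>B\<close> and a part outside, and exchanging the inner parts gives related families
  \<open>D1\<close> (inside from \<open>C h'\<close>) and \<open>D2\<close> (inside from \<open>C h\<close>). Adding \<open>h'\<close> to \<open>D2\<close> keeps it related
  and makes it a covering of \<open>M\<close>, so \<open>D2\<close> has at least \<open>k - 1\<close> members and \<open>D1\<close> fewer than \<open>k\<close>.
  Hence \<open>D1\<close> misses some \<open>g \<in> M\<close> through \<open>x\<close>, which \<open>C h\<close> can only meet inside \<open>B\<close>; then \<open>g, h\<close>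
  with a smaller branch are in the same situation, and descent shows that \<open>M\<close> is a matching.
\<close>

section \<open>Branches of a tree\<close>

text \<open>All that the combinatorial argument uses of a subtree: it induces a connected
  subgraph.\<close>

definition linked_in :: "'a rel \<Rightarrow> 'a set \<Rightarrow> bool" where
  "linked_in E s \<longleftrightarrow> (\<forall>u\<in>s. \<forall>v\<in>s. (u, v) \<in> (Restr E s)\<^sup>*)"

lemma linked_inD: "linked_in E s \<Longrightarrow> u \<in> s \<Longrightarrow> v \<in> s \<Longrightarrow> (u, v) \<in> (Restr E s)\<^sup>*"
  by (auto simp: linked_in_def)

lemma Restr_rtrancl_mono: "(u, v) \<in> (Restr E s)\<^sup>* \<Longrightarrow> s \<subseteq> t \<Longrightarrow> (u, v) \<in> (Restr E t)\<^sup>*"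
  by (erule rtrancl_mono[THEN subsetD, rotated]) blast

lemma Restr_rtrancl_sym: "sym E \<Longrightarrow> (u, v) \<in> (Restr E s)\<^sup>* \<Longrightarrow> (v, u) \<in> (Restr E s)\<^sup>*"
  by (rule symD[OF sym_rtrancl]) (auto simp: sym_def)

lemma Restr_rtrancl_in: "(u, v) \<in> (Restr E s)\<^sup>* \<Longrightarrow> u \<in> s \<Longrightarrow> v \<in> s"
  by (erule rtranclE) auto

lemma last_exit:
  assumes "(u, z) \<in> (Restr E s)\<^sup>*" "u \<in> P" "z \<notin> P"
  obtains x y where "x \<in> P" "x \<in> s" "y \<in> s" "y \<notin> P" "(x, y) \<in> E" "(y, z) \<in> (Restr E (s - P))\<^sup>*"
proof -
  have "z \<in> P \<or> (\<exists>x y. x \<in> P \<and> x \<in> s \<and> y \<in> s \<and> y \<notin> P \<and> (x, y) \<in> E \<and>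
      (y, z) \<in> (Restr E (s - P))\<^sup>*)"
    using assms(1)
  proof induction
    case base
    then show ?case using assms(2) by blast
  next
    case (step z z')
    show ?case
    proof (cases "z' \<in> P \<or> z \<in> P")
      case True
      then show ?thesis using step.hyps by blast
    next
      case False
      then have "(z, z') \<in> Restr E (s - P)" using step.hyps by blast
      then show ?thesis using step.IH False by (meson rtrancl.rtrancl_into_rtrancl)
    qed
  qed
  then show thesis using that assms(3) by blast
qed

text \<open>Absence of cycles in local form: a walk avoiding \<open>x\<close> between two distinct
  neighbours of \<open>x\<close> would close up to a cycle.\<close>

locale acyclic_adjacency =
  fixes E :: "'a rel"
  assumes sym: "sym E"
    and acyc: "(x, y) \<in> E \<Longrightarrow> (x, y') \<in> E \<Longrightarrow> (y, y') \<in> (Restr E (- {x}))\<^sup>* \<Longrightarrow> y = y'"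
begin

text \<open>\<open>B\<close> is the branch at \<open>x\<close> containing \<open>z\<close>, where \<open>x\<close> is the last vertex in \<open>h'\<close> on the path
  from \<open>u\<close> to \<open>z\<close>.\<close>

lemma separation:
  assumes "linked_in E h" "linked_in E h'" "u \<in> h" "u \<in> h'" "z \<in> h" "z \<notin> h'"
  obtains x B where "x \<in> h" "x \<in> h'" "z \<in> B" "h' \<inter> B = {}" "linked_in E B"
    "\<And>s. linked_in E s \<Longrightarrow> s \<subseteq> B \<or> s \<inter> B = {} \<or> x \<in> s"
proof -
  obtain x y where xy: "x \<in> h'" "x \<in> h" "y \<in> h" "y \<notin> h'" "(x, y) \<in> E"
    and yz: "(y, z) \<in> (Restr E (h - h'))\<^sup>*"
    using last_exit[OF linked_inD[OF assms(1,3,5)] assms(4,6)] by metis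
  let ?R = "Restr E (- {x})"
  define B where "B = {v. (y, v) \<in> ?R\<^sup>*}"
  have "y \<noteq> x" using xy by blast
  then have xB: "x \<notin> B" unfolding B_def using Restr_rtrancl_in[of y x E "- {x}"] by auto
  have z: "z \<in> B" unfolding B_def using Restr_rtrancl_mono[OF yz, of "- {x}"] xy(1) by auto
  \<comment> \<open>Inside \<open>h'\<close>, \<open>v\<close> is reached from \<open>x\<close>
    through a neighbour \<open>y'\<close> in \<open>h'\<close>. If \<open>v\<close> were in
    \<open>B\<close>, acyclicity would force \<open>y = y'\<close>, but \<open>y\<close> is outside
    \<open>h'\<close>.\<close>
  have "v \<notin> B" if v: "v \<in> h'" for v
  proof
    assume vB: "v \<in> B"
    then have "v \<notin> {x}" using xB by blast
    then obtain y' where y': "y' \<in> h'" "(x, y') \<in> E" "(y', v) \<in> (Restr E (h' - {x}))\<^sup>*"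
      using last_exit[OF linked_inD[OF assms(2) xy(1) v], of "{x}"] by (metis singletonD singletonI)
    have "(y', v) \<in> ?R\<^sup>*" using Restr_rtrancl_mono[OF y'(3)] by auto
    then have "(y, y') \<in> ?R\<^sup>*"
      using vB Restr_rtrancl_sym[OF sym] unfolding B_def by (meson mem_Collect_eq rtrancl_trans)
    then show False using acyc[OF xy(5) y'(2)] y'(1) xy(4) by blast
  qed
  then have disj: "h' \<inter> B = {}" by blast
  have "(y, v) \<in> (Restr E B)\<^sup>*" if "(y, v) \<in> ?R\<^sup>*" for v
    using that
  proof induction
    case (step v v')
    then have "v \<in> B" "v' \<in> B" unfolding B_def by (auto intro: rtrancl_into_rtrancl)
    then show ?case using step by (auto intro: rtrancl_into_rtrancl)
  qed simp
  then have "(y, v) \<in> (Restr E B)\<^sup>*" if "v \<in> B" for v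
    using that unfolding B_def by blast
  then have conB: "linked_in E B"
    unfolding linked_in_def using Restr_rtrancl_sym[OF sym] by (blast intro: rtrancl_trans)
  have "s \<subseteq> B \<or> s \<inter> B = {} \<or> x \<in> s" if s: "linked_in E s" for s
  proof -
    have "v \<in> B" if "x \<notin> s" "u \<in> s" "u \<in> B" "v \<in> s" for u v
      using Restr_rtrancl_mono[OF linked_inD[OF s that(2,4)], of "- {x}"] that
      unfolding B_def by (auto intro: rtrancl_trans)
    then show ?thesis by blast
  qed
  then show thesis using that xy z disj conB by blast
qed

end

section \<open>Walks in the digraph of a tree\<close>

lemma pawalk_verts_snoc: "pcas u p v \<Longrightarrow> pawalk_verts u (p @ [(v, x)]) = pawalk_verts u p @ [x]"
  by (induction p arbitrary: u) auto

lemma reachable_imp_linked: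
  assumes "(u, v) \<in> rtrancl_on A r" "r \<subseteq> E"
  shows "(u, v) \<in> (Restr E A)\<^sup>*"
  using assms(1)
proof (induction rule: rtrancl_on_induct)
  case (step y z)
  then have "(y, z) \<in> Restr E A" using assms(2) by blast
  then show ?case using step.IH by (rule rtrancl_into_rtrancl[rotated])
qed simp

lemma undirected_tree_acyclic_adjacency:
  assumes "undirected_tree T"
  shows "acyclic_adjacency (parcs T)"
proof
  interpret T: pair_bidirected_digraph T
    using assms by (simp add: undirected_tree_def)
  show "sym (parcs T)"
    using T.arcs_symmetric by (auto simp: sym_def)
  fix x y y'
  assume xy: "(x, y) \<in> parcs T" and xy': "(x, y') \<in> parcs T"
    and r: "(y, y') \<in> (Restr (parcs T) (- {x}))\<^sup>*"
  show "y = y'"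
  proof (rule ccontr)
    assume ne: "y \<noteq> y'"
    \<comment> \<open>The tree with \<open>x\<close> deleted: a path found here cannot pass through
      \<open>x\<close>, so closing it up at \<open>x\<close> repeats no vertex.\<close>
    define S where "S = \<lparr>pverts = pverts T - {x}, parcs = Restr (parcs T) (- {x})\<rparr>"
    interpret S: pair_wf_digraph S
      by unfold_locales (auto simp: S_def dest: T.wellformed')
    have "y \<noteq> x" using r ne by (auto elim: converse_rtranclE)
    have "(y, y') \<in> rtrancl_on (pverts S) (parcs S)"
      using r
    proof induction
      case base
      then show ?case using T.wellformed'(2)[OF xy] \<open>y \<noteq> x\<close> by (simp add: S_def)
    next
      case (step v v')
      then show ?case
        using T.wellformed'(2)[of v v']
        by (intro rtrancl_on_into_rtrancl_on[OF step.IH]) (auto simp: S_def)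
    qed
    then have "y \<rightarrow>\<^sup>*\<^bsub>with_proj S\<^esub> y'"
      by (simp add: reachable_def)
    then obtain p where "S.apath y p y'"
      using S.reachable_awalk S.apath_awalk_to_apath by blast
    then have walk: "S.awalk y p y'" and dist: "distinct (pawalk_verts y p)"
      by (simp_all only: S.apath_def)
    then have p: "set p \<subseteq> parcs S" "pcas y p y'" "set (pawalk_verts y p) \<subseteq> pverts S"
      by (blast elim: S.awalkE)+
    let ?c = "(x, y) # p @ [(y', x)]"
    \<comment> \<open>At least one arc in \<open>p\<close> plus the two at \<open>x\<close> give
      length 3, which excludes the degenerate cycle along a single edge.\<close>
    have "p \<noteq> []" using p(2) ne by auto
    then have len: "3 \<le> length ?c" by (cases p) auto
    have "(y', x) \<in> parcs T" using xy' T.arcs_symmetric by blast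
    then have "T.awalk x ?c x"
      using p(1,2) xy T.wellformed'(1)[OF xy] T.awlast_if_cas[OF p(2)]
      by (auto simp: T.awalk_def S_def)
    moreover have "distinct (tl (pawalk_verts x ?c))"
      using p dist by (auto simp: pawalk_verts_snoc S_def)
    ultimately have "T.cycle ?c" by (auto simp: T.cycle_def)
    then show False using assms len unfolding undirected_tree_def by blast
  qed
qed

lemma subtrees_linked_in:
  assumes "undirected_tree T" "s \<in> subtrees T"
  shows "linked_in (parcs T) s"
proof -
  obtain t where t: "s = pverts t" "subgraph (with_proj t) (with_proj T)" "undirected_tree t"
    using assms(2) by (auto simp: subtrees_def)
  interpret T: pair_bidirected_digraph T
    using assms(1) by (simp add: undirected_tree_def)
  have sub: "parcs t \<subseteq> parcs T" using t(2) by (auto simp: subgraph_def)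
  \<comment> \<open>\<open>connected\<close> speaks of the symmetric closure, whose arcs lie in
    \<open>T\<close> because \<open>T\<close> is symmetric.\<close>
  have "parcs (mk_symmetric (with_proj t)) \<subseteq> parcs T"
    using sub T.arcs_symmetric by (auto simp: parcs_mk_symmetric)
  moreover have "\<forall>u\<in>s. \<forall>v\<in>s. (u, v) \<in> rtrancl_on s (parcs (mk_symmetric (with_proj t)))"
    using t(1,3) by (auto simp: undirected_tree_def connected_def strongly_connected_def reachable_def)
  ultimately show ?thesis
    unfolding linked_in_def by (blast intro: reachable_imp_linked)
qed

section \<open>Critical families\<close>

lemma coveringD: "covering H C \<Longrightarrow> h \<in> H \<Longrightarrow> \<exists>c\<in>C. \<not> disjnt h c"
  by (auto simp: covering_def)

lemma covering_mono: "covering H C \<Longrightarrow> H' \<subseteq> H \<Longrightarrow> covering H' C"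
  by (auto simp: covering_def)

context acyclic_adjacency
begin

lemma exchange_descent:
  fixes k :: enat
  assumes link: "\<And>s. s \<in> H2 \<Longrightarrow> linked_in E s" and fin: "finite H2" and "M \<subseteq> H2"
    and sim: "\<And>x y. x \<in> H2 \<Longrightarrow> y \<in> H2 \<Longrightarrow> disjnt x y \<Longrightarrow> sim x y"
    and k: "\<And>D. D \<subseteq> H2 \<Longrightarrow> pairwise sim D \<Longrightarrow> covering M D \<Longrightarrow> k \<le> enat (card D)"
    and C: "\<And>h. h \<in> M \<Longrightarrow> C h \<subseteq> H2" "\<And>h. h \<in> M \<Longrightarrow> pairwise sim (C h)"
      "\<And>h. h \<in> M \<Longrightarrow> covering (M - {h}) (C h)" "\<And>h. h \<in> M \<Longrightarrow> enat (card (C h)) < k"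
    and avoid: "\<And>h c. h \<in> M \<Longrightarrow> c \<in> C h \<Longrightarrow> disjnt h c"
    and "h \<in> M" "h' \<in> M" "x \<in> h" "x \<in> h'" "h' \<inter> B = {}" "linked_in E B"
    and cut: "\<And>s. linked_in E s \<Longrightarrow> s \<subseteq> B \<or> s \<inter> B = {} \<or> x \<in> s"
    and "c \<in> C h'" "z \<in> c" "z \<in> h" "z \<in> B"
  shows False
  using assms(11-)
proof (induction "card {c \<in> H2. c \<subseteq> B}" arbitrary: h h' x B c z rule: less_induct)
  case less
  note hM = \<open>h \<in> M\<close> \<open>h' \<in> M\<close> and x = \<open>x \<in> h\<close> \<open>x \<in> h'\<close> and cut = less.prems(7)
    and c = \<open>c \<in> C h'\<close> \<open>z \<in> c\<close> \<open>z \<in> h\<close> \<open>z \<in> B\<close>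
  \<comment> \<open>As \<open>x\<close> lies in \<open>h\<close> and \<open>h'\<close>,
    \<open>avoid\<close> keeps it out of every member of both coverings, so \<open>cut\<close>
    applies.\<close>
  have side: "s \<subseteq> B \<or> s \<inter> B = {}" if "s \<in> C h \<union> C h'" for s
  proof -
    have "s \<in> H2" "x \<notin> s" using that C(1) hM x avoid by (auto simp: disjnt_iff)
    then show ?thesis using cut link by blast
  qed
  have "h \<noteq> h'" using avoid[OF hM(2) c(1)] c(2,3) by (auto simp: disjnt_iff)
  have H2: "C h \<subseteq> H2" "C h' \<subseteq> H2" "M \<subseteq> H2" using C(1) hM assms(3) by auto
  have fins: "finite (C h)" "finite (C h')" using H2 fin finite_subset by blast+
  define in_B out_B where "in_B X = {c \<in> X. c \<subseteq> B}" and "out_B X = {c \<in> X. \<not> c \<subseteq> B}"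
    for X :: "'a set set"
  have card_split: "card (in_B X) + card (out_B X) = card X" if "finite X" for X
  proof -
    have "X = in_B X \<union> out_B X" "in_B X \<inter> out_B X = {}" by (auto simp: in_B_def out_B_def)
    then show ?thesis using that by (metis card_Un_disjoint finite_Un)
  qed
  have related: "pairwise sim (in_B X \<union> out_B Y)"
    if "X \<subseteq> C h \<union> C h'" "Y \<subseteq> C h \<union> C h'" "pairwise sim X" "pairwise sim Y" for X Y
  proof -
    have "sim s t \<and> sim t s" if st: "s \<in> in_B X" "t \<in> out_B Y" for s t
    proof -
      have "s \<in> H2" "t \<in> H2" using st \<open>X \<subseteq> _\<close> \<open>Y \<subseteq> _\<close> H2 by (auto simp: in_B_def out_B_def)
      moreover have "disjnt s t"
        using st \<open>Y \<subseteq> _\<close> side unfolding in_B_def out_B_def disjnt_def by blast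
      ultimately show ?thesis using sim disjnt_sym by metis
    qed
    moreover have "pairwise sim (in_B X)" "pairwise sim (out_B Y)"
      using that(3,4) by (auto simp: pairwise_def in_B_def out_B_def)
    ultimately show ?thesis unfolding pairwise_def by blast
  qed
  define D1 where "D1 = in_B (C h') \<union> out_B (C h)"
  define D2 where "D2 = in_B (C h) \<union> out_B (C h')"
  have D2_h': "disjnt h' d" if "d \<in> D2" for d
    using that avoid[OF hM(2)] \<open>h' \<inter> B = {}\<close> unfolding D2_def in_B_def out_B_def disjnt_def by blast
  have DH: "D1 \<subseteq> H2" "D2 \<subseteq> H2" using H2 by (auto simp: D1_def D2_def in_B_def out_B_def)
  have meets: "\<exists>d\<in>C h''. \<not> disjnt g d" if "g \<in> M" "h'' \<in> M" "g \<noteq> h''" for g h''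
    using coveringD[OF C(3)[OF that(2)]] that by blast
  \<comment> \<open>Members of \<open>M\<close> through \<open>x\<close> meet \<open>h'\<close>. Any
    other one lies on one side of \<open>B\<close> and differs from \<open>h\<close> and
    \<open>h'\<close>; the covering whose part on that side went into \<open>D2\<close> meets it
    there.\<close>
  have "covering M (insert h' D2)"
    unfolding covering_def
  proof
    fix g assume g: "g \<in> M"
    consider "x \<in> g" | "x \<notin> g" "g \<subseteq> B" | "x \<notin> g" "g \<inter> B = {}"
      using cut[OF link] g H2(3) by blast
    then show "\<exists>d\<in>insert h' D2. \<not> disjnt g d"
    proof cases
      case 1
      then show ?thesis using x by (auto simp: disjnt_iff)
    next
      case 2
      then obtain d where "d \<in> C h" "\<not> disjnt g d" using meets[OF g hM(1)] x by blast
      then show ?thesis using side[of d] 2 unfolding D2_def in_B_def disjnt_def by blast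
    next
      case 3
      then obtain d where "d \<in> C h'" "\<not> disjnt g d" using meets[OF g hM(2)] x by blast
      then show ?thesis using side[of d] 3 unfolding D2_def out_B_def disjnt_def by blast
    qed
  qed
  moreover have "pairwise sim D2"
    unfolding D2_def using related[of "C h" "C h'"] C(2) hM by blast
  then have "pairwise sim (insert h' D2)"
    using D2_h' DH(2) H2(3) hM(2) sim
    by (auto simp: pairwise_insert disjnt_sym subset_iff)
  ultimately have "k \<le> enat (card (insert h' D2))"
    using k DH H2(3) hM(2) by blast
  moreover have "card (insert h' D2) \<le> Suc (card D2)"
    by (rule card_insert_le_m1) auto
  moreover have "card D1 + card D2 \<le> card (C h) + card (C h')"
    using card_split[OF fins(1)] card_split[OF fins(2)]
      card_Un_le[of "in_B (C h')" "out_B (C h)"] card_Un_le[of "in_B (C h)" "out_B (C h')"]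
    unfolding D1_def D2_def by linarith
  \<comment> \<open>For finite \<open>k\<close>, the two coverings have at most
    \<open>2 * (k - 1)\<close> members together and \<open>D2\<close> has at least
    \<open>k - 1\<close>, leaving at most \<open>k - 1\<close> for \<open>D1\<close>.\<close>
  ultimately have "enat (card D1) < k"
    using C(4)[OF hM(1)] C(4)[OF hM(2)] by (cases k) auto
  moreover have "pairwise sim D1"
    unfolding D1_def using related[of "C h'" "C h"] C(2) hM by blast
  ultimately have "\<not> covering M D1" using k[of D1] DH by force
  then obtain g where g: "g \<in> M" and missed: "\<And>d. d \<in> D1 \<Longrightarrow> disjnt g d"
    by (auto simp: covering_def)
  have "g \<noteq> h"
    using missed[of c] c unfolding D1_def in_B_def using side[of c] by (auto simp: disjnt_iff)
  then obtain d where d: "d \<in> C h" "\<not> disjnt g d" using meets[OF g hM(1)] by blast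
  then have "d \<subseteq> B" using missed[of d] by (auto simp: D1_def out_B_def)
  then obtain z' where z': "z' \<in> g" "z' \<in> d" "z' \<in> B" using d by (auto simp: disjnt_iff)
  \<comment> \<open>Otherwise \<open>g\<close> lies inside \<open>B\<close>, where \<open>D1\<close>
    contains the members of \<open>C h'\<close> that meet it.\<close>
  have "x \<in> g"
  proof (rule ccontr)
    assume "x \<notin> g"
    then have "g \<subseteq> B" "g \<noteq> h'" using cut[OF link] g H2(3) z' x by blast+
    then obtain d' where "d' \<in> C h'" "\<not> disjnt g d'" using meets[OF g hM(2)] by blast
    then show False
      using missed[of d'] side[of d'] \<open>g \<subseteq> B\<close> unfolding D1_def in_B_def disjnt_def by blast
  qed
  have "z' \<notin> h" using avoid[OF hM(1) d(1)] z' by (auto simp: disjnt_iff)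
  \<comment> \<open>In the next configuration \<open>g\<close>, \<open>h\<close>, \<open>d\<close>
    play the roles of \<open>h\<close>, \<open>h'\<close>, \<open>c\<close>. The measure drops:
    \<open>B'\<close> misses \<open>x\<close> and so stays within \<open>B\<close>, while
    \<open>c\<close> lies in \<open>B\<close> but meets \<open>h\<close>, hence not within
    \<open>B'\<close>.\<close>
  then obtain x' B' where B': "x' \<in> g" "x' \<in> h" "z' \<in> B'" "h \<inter> B' = {}" "linked_in E B'"
    "\<And>s. linked_in E s \<Longrightarrow> s \<subseteq> B' \<or> s \<inter> B' = {} \<or> x' \<in> s"
    using separation[of g h x z'] link H2(3) g hM(1) \<open>x \<in> g\<close> x z'(1) by (metis subsetD)
  have "B' \<subseteq> B" using cut[OF B'(5)] B'(3,4) x z'(3) by blast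
  moreover have "c \<subseteq> B" using side[of c] c by blast
  moreover have "\<not> c \<subseteq> B'" using c B'(4) by blast
  ultimately have "{c \<in> H2. c \<subseteq> B'} \<subset> {c \<in> H2. c \<subseteq> B}" using c(1) H2(2) by blast
  then have "card {c \<in> H2. c \<subseteq> B'} < card {c \<in> H2. c \<subseteq> B}"
    using fin by (intro psubset_card_mono) auto
  then show False
    using less.hyps[of B' g h x' d z'] g hM(1) B' d(1) z' by blast
qed

lemma critical_family_disjoint:
  fixes k :: enat
  assumes link: "\<And>s. s \<in> H2 \<Longrightarrow> linked_in E s" and fin: "finite H2" and "M \<subseteq> H2"
    and sim: "\<And>x y. x \<in> H2 \<Longrightarrow> y \<in> H2 \<Longrightarrow> disjnt x y \<Longrightarrow> sim x y"
    and k: "\<And>D. D \<subseteq> H2 \<Longrightarrow> pairwise sim D \<Longrightarrow> covering M D \<Longrightarrow> k \<le> enat (card D)"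
    and critical: "\<And>h. h \<in> M \<Longrightarrow>
      \<exists>D \<subseteq> H2. pairwise sim D \<and> covering (M - {h}) D \<and> enat (card D) < k"
  shows "pairwise disjnt M"
proof (rule pairwiseI, rule ccontr)
  fix h h' assume h: "h \<in> M" "h' \<in> M" "h \<noteq> h'" and "\<not> disjnt h h'"
  then obtain u where u: "u \<in> h" "u \<in> h'" by (auto simp: disjnt_iff)
  obtain C where C: "\<And>h. h \<in> M \<Longrightarrow> C h \<subseteq> H2" "\<And>h. h \<in> M \<Longrightarrow> pairwise sim (C h)"
      "\<And>h. h \<in> M \<Longrightarrow> covering (M - {h}) (C h)" "\<And>h. h \<in> M \<Longrightarrow> enat (card (C h)) < k"
    using critical by metis
  \<comment> \<open>Otherwise \<open>C h\<close> would cover all of \<open>M\<close> with fewer than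
    \<open>k\<close> members.\<close>
  have avoid: "disjnt h c" if "h \<in> M" "c \<in> C h" for h c
  proof (rule ccontr)
    assume "\<not> disjnt h c"
    then have "covering M (C h)" using C(3)[OF that(1)] that by (auto simp: covering_def)
    then show False using k C that(1) by (meson not_le)
  qed
  \<comment> \<open>\<open>C h'\<close> meets \<open>h\<close> but avoids \<open>h'\<close>; the
    branch towards such a meeting point \<open>z\<close> starts the descent.\<close>
  obtain c z where c: "c \<in> C h'" "z \<in> c" "z \<in> h"
    using coveringD[OF C(3)[OF h(2)], of h] h by (auto simp: disjnt_iff)
  then have "z \<notin> h'" using avoid[OF h(2)] by (auto simp: disjnt_iff)
  then obtain x B where B: "x \<in> h" "x \<in> h'" "z \<in> B" "h' \<inter> B = {}" "linked_in E B"
    "\<And>s. linked_in E s \<Longrightarrow> s \<subseteq> B \<or> s \<inter> B = {} \<or> x \<in> s"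
    using separation[of h h' u z] link assms(3) h u c(3) by (metis subsetD)
  show False
    by (rule exchange_descent[OF link fin assms(3) sim k C avoid h(1,2) B(1,2,4,5,6) c B(3)])
qed

end

section \<open>Width and matching width\<close>

lemma w_le:
  "C \<subseteq> H2 \<Longrightarrow> finite C \<Longrightarrow> pairwise sim C \<Longrightarrow> covering H1 C \<Longrightarrow> w H1 H2 sim \<le> enat (card C)"
  unfolding w_def by (rule INF_lower) blast

lemma w_mono: "H \<subseteq> H' \<Longrightarrow> w H H2 sim \<le> w H' H2 sim"
  unfolding w_def by (rule INF_superset_mono) (auto intro: covering_mono)

lemma w_lessE:
  assumes "w H H2 sim < k"
  obtains C where "C \<subseteq> H2" "pairwise sim C" "covering H C" "enat (card C) < k"
  using assms unfolding w_def INF_less_iff by blast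

theorem theorem1p2:
  fixes T :: "'a pair_pre_digraph"
    and H1 H2 :: "'a set set"
    and sim :: "'a set \<Rightarrow> 'a set \<Rightarrow> bool"
  assumes "undirected_tree T"
    and "H1 \<subseteq> H2" and "H2 \<subseteq> subtrees T" and "finite H2"
    and "symp_on H2 sim"
    and "\<And>x y. x \<in> H2 \<Longrightarrow> y \<in> H2 \<Longrightarrow> disjnt x y \<Longrightarrow> sim x y"
  shows "mw H1 H2 sim = w H1 H2 sim"
proof -
  interpret acyclic_adjacency "parcs T"
    using assms(1) by (rule undirected_tree_acyclic_adjacency)
  have fin: "finite H1" using assms(2,4) finite_subset by blast
  let ?k = "w H1 H2 sim"
  obtain M where M: "M \<subseteq> H1" "w M H2 sim = ?k"
    and min: "\<And>N. N \<subseteq> H1 \<Longrightarrow> w N H2 sim = ?k \<Longrightarrow> card M \<le> card N"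
    using ex_has_least_nat[of "\<lambda>N. N \<subseteq> H1 \<and> w N H2 sim = ?k" H1 card] by blast
  \<comment> \<open>Monotonicity gives \<open>\<le>\<close>; equality would contradict the minimal
    cardinality of \<open>M\<close>.\<close>
  have critical: "w (M - {h}) H2 sim < ?k" if "h \<in> M" for h
  proof -
    have "finite M" using M(1) fin finite_subset by blast
    then have "card (M - {h}) < card M" using that by (rule card_Diff1_less)
    then have "w (M - {h}) H2 sim \<noteq> ?k" using min[of "M - {h}"] M(1) by auto
    then show ?thesis using w_mono[of "M - {h}" M H2 sim] M(2) by auto
  qed
  have "pairwise disjnt M"
  proof (rule critical_family_disjoint[of H2 M sim ?k])
    show "linked_in (parcs T) s" if "s \<in> H2" for s
      using subtrees_linked_in assms(1,3) that by blast
    show "?k \<le> enat (card D)" if "D \<subseteq> H2" "pairwise sim D" "covering M D" for D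
      using w_le[of D H2 sim M] that M(2) finite_subset[OF _ assms(4)] by auto
    show "\<exists>D \<subseteq> H2. pairwise sim D \<and> covering (M - {h}) D \<and> enat (card D) < ?k"
      if "h \<in> M" for h
      using critical[OF that] by (rule w_lessE) blast
  qed (use assms M in auto)
  then have "matching_in H1 M" using M(1) by (simp add: matching_in_def)
  \<comment> \<open>Monotonicity bounds the width of every matching by \<open>?k\<close>, and
    \<open>M\<close> attains it.\<close>
  show ?thesis
    unfolding mw_def
  proof (rule Max_eqI)
    have "{w M H2 sim |M. matching_in H1 M} \<subseteq> (\<lambda>M. w M H2 sim) ` Pow H1"
      by (auto simp: matching_in_def)
    then show "finite {w M H2 sim |M. matching_in H1 M}"
      using fin finite_subset by blast
    show "?k \<in> {w M H2 sim |M. matching_in H1 M}"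
      using M(2)[symmetric] \<open>matching_in H1 M\<close> by blast
    show "y \<le> ?k" if "y \<in> {w M H2 sim |M. matching_in H1 M}" for y
      using that w_mono by (auto simp: matching_in_def)
  qed
qed

end
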